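(* Let $C_{1},\ldots,C_{m}\in\mathbb{R}_{+}^{n\times n}$ be pairwise comparison matrices with nonzero spectral radii, and let $B\in\mathbb{R}_{+}^{n\times n}$ be a matrix such that $\mathrm{Tr}(B)\leq 1$ (all matrix operations are in max-algebra). Consider the multiobjective problem of minimizing $(x^{-}C_{1}x,\ldots,x^{-}C_{m}x)$ over regular vectors $x\in\mathbb{R}_{+}^{n}$ subject to $Bx\leq x$. Denote $B_{0}=B$ and define, for $s=1,\ldots,m$, $$\theta_{s}=\bigoplus_{k=1}^{n}\ \bigoplus_{0\leq i_{1}+\cdots+i_{k}\leq n-k}\mathrm{tr}^{1/k}(C_{s}B_{s-1}^{i_{1}}\cdots C_{s}B_{s-1}^{i_{k}}),\qquad B_{s}=\theta_{s}^{-1}C_{s}\oplus B_{s-1},$$ where $i_1,\ldots,i_k$ range over nonnegative integers. Then, with $G=B_{m}^{\ast}$ and $g_1,\ldots,g_n$ the columns of $G$, the following statements hold: (i) All lexicographic ordering solutions of the problem are given in the parametric form $x=Gu$, $u\in\mathbb{R}_+^n$, $u\neq 0$. (ii) The minimal normalized best differentiating solution is given by $$x^{\mathrm{best}}=g_{k}\|g_{k}\|^{-1},\qquad k\in\arg\max_{1\leq j\leq n}\|g_{j}\|\,\|g_{j}^{-}\|.$$ (iii) The maximal normalized worst differentiating solution is $x^{\mathrm{worst}}=(\mathbf{1}^{T}G)^{-}$.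
   Context: Max-algebra: the set $\mathbb{R}_{+}$ of nonnegative reals with addition $a\oplus b=\max(a,b)$ and the usual multiplication. Matrices and vectors over $\mathbb{R}_+$ are added and multiplied by the usual rules with $+$ replaced by $\oplus$; inequalities are entrywise; $I$ is the usual identity matrix; $A^{0}=I$, $A^{p}=AA^{p-1}$ for integers $p\geq 1$. A vector is regular if it has no zero entries. $\mathbf{1}=(1,\ldots,1)^{T}$. The conjugate of a nonzero matrix $A=(a_{ij})$ is $A^{-}=(a^{-}_{ij})$, of transposed size, with $a^{-}_{ij}=a_{ji}^{-1}$ if $a_{ji}\neq 0$ and $0$ otherwise (likewise for row and column vectors). $\|x\|=\max_{j}x_{j}$ for row or column vectors. For $A=(a_{ij})\in\mathbb{R}_+^{n\times n}$: $\mathrm{tr}A=\bigoplus_{k}a_{kk}$; $\mathrm{tr}^{1/k}(A)=(\mathrm{tr}A)^{1/k}$; $\mathrm{Tr}(A)=\bigoplus_{k=1}^{n}\mathrm{tr}A^{k}$; the spectral radius is $\bigoplus_{k=1}^{n}\mathrm{tr}^{1/k}(A^{k})$; if $\mathrm{Tr}(A)\leq 1$, the Kleene star is $A^{\ast}=\bigoplus_{k=0}^{n-1}A^{k}$. A pairwise comparison matrix is a matrix $C=(c_{ij})$ with $c_{ij}>0$ and $c_{ij}=1/c_{ji}$ for all $i,j$. Lexicographic ordering solutions: let $X_{0}$ be the set of regular $x$ with $Bx\leq x$, and for $s=1,\ldots,m$ let $X_{s}$ be the set of minimizers of $x^{-}C_{s}x$ over $x\in X_{s-1}$. The lexicographic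 ordering solutions are the elements of $X_{m}$ (one may stop earlier if $X_s$ consists of a single vector up to a positive factor, as then the set no longer changes). Let $X=X_m$ be the set of lexicographic ordering solutions. A normalized best (respectively worst) differentiating solution is a vector that maximizes (respectively minimizes) $x^{-}\mathbf{1}=\max_i x_i^{-1}$ over all $x\in X$ with $\mathbf{1}^{T}x=\max_i x_i=1$. The maximal worst differentiating solution is the worst differentiating solution that is entrywise $\geq$ every other one. The minimal best differentiating solution is "given by" a finite set $S$ of vectors in the following sense: each vector of $S$ is a normalized best differentiating solution, and every normalized best differentiating solution is entrywise $\geq$ some vector of $S$; if $S$ has an entrywise least element, that is the unique minimal best differentiating solution, and otherwise the minimal solution is not uniquely determined. *)

theory Defs
  imports "HOL-Analysis.Analysis"
begin

text \<open>Max-algebra on nonnegative reals. Entries are of type \<open>real\<close>; nonnegativity is a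
  hypothesis wherever a matrix or vector ranges over \<open>\<real>\<^sub>+\<close>. The order \<open>\<le>\<close> on vectors and
  matrices is the entrywise one of the library, \<open>mat 1\<close> is the identity matrix, and scaling
  by a scalar is the ordinary \<open>*\<^sub>R\<close>. The matrix dimension \<open>n\<close> is \<open>CARD('n)\<close>. Row and column
  vectors have the same type.\<close>

definition madd :: "real^'n^'n \<Rightarrow> real^'n^'n \<Rightarrow> real^'n^'n"  (infixl "\<oplus>" 65) where
  "A \<oplus> B = (\<chi> i j. max (A $ i $ j) (B $ i $ j))"

definition mmul :: "real^'n^'n \<Rightarrow> real^'n^'n \<Rightarrow> real^'n^'n"  (infixr "\<otimes>" 70) where
  "A \<otimes> B = (\<chi> i j. MAX k. A $ i $ k * B $ k $ j)"

definition mmulv :: "real^'n^'n \<Rightarrow> real^'n \<Rightarrow> real^'n"  (infixr "\<otimes>v" 70) where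
  "A \<otimes>v x = (\<chi> i. MAX j. A $ i $ j * x $ j)"

definition vmulm :: "real^'n \<Rightarrow> real^'n^'n \<Rightarrow> real^'n"  (infixl "v\<otimes>" 70) where
  "x v\<otimes> A = (\<chi> j. MAX i. x $ i * A $ i $ j)"

definition mdot :: "real^'n \<Rightarrow> real^'n \<Rightarrow> real" where
  "mdot x y = (MAX i. x $ i * y $ i)"

primrec mpow :: "real^'n^'n \<Rightarrow> nat \<Rightarrow> real^'n^'n" where
  "mpow A 0 = mat 1"
| "mpow A (Suc p) = A \<otimes> mpow A p"

definition regular :: "real^'n \<Rightarrow> bool" where
  "regular x \<longleftrightarrow> 0 \<le> x \<and> (\<forall>i. x $ i \<noteq> 0)"

definition conjugate :: "real^'n \<Rightarrow> real^'n" where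
  "conjugate x = (\<chi> i. if x $ i \<noteq> 0 then inverse (x $ i) else 0)"

definition vmax :: "real^'n \<Rightarrow> real" where
  "vmax x = (MAX i. x $ i)"

definition mtr :: "real^'n^'n \<Rightarrow> real" where
  "mtr A = (MAX i. A $ i $ i)"

definition mTr :: "real^'n^'n \<Rightarrow> real" where
  "mTr A = (MAX k\<in>{1..CARD('n)}. mtr (mpow A k))"

definition mspectral_radius :: "real^'n^'n \<Rightarrow> real" where
  "mspectral_radius A = (MAX k\<in>{1..CARD('n)}. root k (mtr (mpow A k)))"

text \<open>The Kleene star is used only for matrices with \<open>mTr A \<le> 1\<close>.\<close>

definition kleene_star :: "real^'n^'n \<Rightarrow> real^'n^'n" where
  "kleene_star A = (\<chi> i j. MAX k\<in>{..<CARD('n)}. mpow A k $ i $ j)"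

definition pairwise_comparison :: "real^'n^'n \<Rightarrow> bool" where
  "pairwise_comparison C \<longleftrightarrow> (\<forall>i j. C $ i $ j > 0 \<and> C $ i $ j = 1 / C $ j $ i)"

text \<open>For a list \<open>[i\<^sub>1, \<dots>, i\<^sub>k]\<close> this is \<open>C B\<^bsup>i\<^sub>1\<^esup> \<cdots> C B\<^bsup>i\<^sub>k\<^esup>\<close>.\<close>

definition word_prod :: "real^'n^'n \<Rightarrow> real^'n^'n \<Rightarrow> nat list \<Rightarrow> real^'n^'n" where
  "word_prod C B is = foldr (\<lambda>i P. C \<otimes> mpow B i \<otimes> P) is (mat 1)"

definition theta :: "real^'n^'n \<Rightarrow> real^'n^'n \<Rightarrow> real" where
  "theta C B =
     (MAX k\<in>{1..CARD('n)}.
        MAX is\<in>{is. length is = k \<and> sum_list is \<le> CARD('n) - k}.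
          root k (mtr (word_prod C B is)))"

primrec Bmat :: "(nat \<Rightarrow> real^'n^'n) \<Rightarrow> real^'n^'n \<Rightarrow> nat \<Rightarrow> real^'n^'n" where
  "Bmat C B 0 = B"
| "Bmat C B (Suc s) =
     (inverse (theta (C (Suc s)) (Bmat C B s)) *\<^sub>R C (Suc s)) \<oplus> Bmat C B s"

primrec lex_solutions :: "(nat \<Rightarrow> real^'n^'n) \<Rightarrow> real^'n^'n \<Rightarrow> nat \<Rightarrow> (real^'n) set" where
  "lex_solutions C B 0 = {x. regular x \<and> B \<otimes>v x \<le> x}"
| "lex_solutions C B (Suc s) =
     {x. is_arg_min (\<lambda>x. mdot (conjugate x) (C (Suc s) \<otimes>v x))
           (\<lambda>x. x \<in> lex_solutions C B s) x}"

definition best_diff :: "(real^'n) set \<Rightarrow> (real^'n) set" where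
  "best_diff X =
     {x. is_arg_max (\<lambda>x. mdot (conjugate x) 1) (\<lambda>x. x \<in> X \<and> mdot 1 x = 1) x}"

definition worst_diff :: "(real^'n) set \<Rightarrow> (real^'n) set" where
  "worst_diff X =
     {x. is_arg_min (\<lambda>x. mdot (conjugate x) 1) (\<lambda>x. x \<in> X \<and> mdot 1 x = 1) x}"

definition minimal_in :: "'a::order set \<Rightarrow> 'a \<Rightarrow> bool" where
  "minimal_in T x \<longleftrightarrow> x \<in> T \<and> (\<forall>y\<in>T. y \<le> x \<longrightarrow> y = x)"

text \<open>The minimal element of \<open>T\<close> is given by the finite set \<open>S\<close>: it is unique if \<open>S\<close> has a
  least element (and is that element), and not uniquely determined otherwise.\<close>

definition minimal_given_by :: "'a::order set \<Rightarrow> 'a set \<Rightarrow> bool" where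
  "minimal_given_by T S \<longleftrightarrow>
     finite S \<and> S \<subseteq> T \<and> (\<forall>x\<in>T. \<exists>s\<in>S. s \<le> x) \<and>
     (\<forall>s\<in>S. (\<forall>t\<in>S. s \<le> t) \<longrightarrow> (\<forall>x. minimal_in T x \<longleftrightarrow> x = s)) \<and>
     (\<not> (\<exists>s\<in>S. \<forall>t\<in>S. s \<le> t) \<longrightarrow> \<not> (\<exists>!x. minimal_in T x))"

definition greatest_in :: "'a::order set \<Rightarrow> 'a \<Rightarrow> bool" where
  "greatest_in T x \<longleftrightarrow> x \<in> T \<and> (\<forall>y\<in>T. y \<le> x)"

end

theory Submission
  imports Defs
begin

text \<open>For a regular vector \<open>x\<close>, the bound \<open>x\<^sup>- C x \<le> t\<close> means \<open>C x \<le> t x\<close>; together with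
  \<open>B x \<le> x\<close> it becomes the single inequality \<open>(t\<^bsup>-1\<^esup> C \<oplus> B) x \<le> x\<close>, which has a regular solution
  if and only if \<open>Tr (t\<^bsup>-1\<^esup> C \<oplus> B) \<le> 1\<close>. Expanding the traces of powers into words in \<open>C\<close> and
  \<open>B\<close>, and rotating every word that contains a \<open>C\<close> so that it starts with one, this condition
  reads \<open>\<theta> \<le> t\<close>. So each stage of the lexicographic minimization replaces \<open>B\<^bsub>s-1\<^esub>\<close> by
  \<open>B\<^bsub>s\<^esub>\<close>, and the final solution set is that of \<open>B\<^bsub>m\<^esub> x \<le> x\<close>, generated by the
  columns of the Kleene star \<open>G\<close>. A normalized solution dominates some normalized column of
  \<open>G\<close>, which settles the best differentiating solutions; it is dominated by
  \<open>(1\<^sup>T G)\<^sup>-\<close>, itself a normalized solution, which settles the worst ones.\<close>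

section \<open>Max-algebra of nonnegative matrices\<close>

lemma mat_nonneg_iff: "0 \<le> (A :: real^'n^'n) \<longleftrightarrow> (\<forall>i j. 0 \<le> A $ i $ j)"
  by (simp add: less_eq_vec_def)

lemma MAX_UNIV_le_iff: "(MAX k. f k) \<le> z \<longleftrightarrow> (\<forall>k. f k \<le> z)"
  for f :: "'n::finite \<Rightarrow> real"
  by auto

lemma MAX_UNIV_attained: "\<exists>k. (MAX k. f k) = f k" for f :: "'n::finite \<Rightarrow> real"
proof -
  have "(MAX k. f k) \<in> range f" by (rule Max_in) auto
  then show ?thesis by (auto simp only: image_iff)
qed

lemma mmul_le_iff: "(A \<otimes> B) $ i $ j \<le> z \<longleftrightarrow> (\<forall>k. A $ i $ k * B $ k $ j \<le> z)"
  unfolding mmul_def by (simp add: MAX_UNIV_le_iff)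

lemma mmul_ge: "A $ i $ k * B $ k $ j \<le> (A \<otimes> B) $ i $ j"
  using mmul_le_iff[of A B i j] by blast

lemma mmul_attained: "\<exists>k. (A \<otimes> B) $ i $ j = A $ i $ k * B $ k $ j"
  unfolding mmul_def using MAX_UNIV_attained[of "\<lambda>k. A $ i $ k * B $ k $ j"] by simp

lemma mmulv_le_iff: "(A \<otimes>v x) $ i \<le> z \<longleftrightarrow> (\<forall>k. A $ i $ k * x $ k \<le> z)"
  unfolding mmulv_def by (simp add: MAX_UNIV_le_iff)

lemma mmulv_ge: "A $ i $ k * x $ k \<le> (A \<otimes>v x) $ i"
  using mmulv_le_iff[of A x i] by blast

lemma mmulv_attained: "\<exists>k. (A \<otimes>v x) $ i = A $ i $ k * x $ k"
  unfolding mmulv_def using MAX_UNIV_attained[of "\<lambda>k. A $ i $ k * x $ k"] by simp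

lemma mmulv_le_vec_iff: "A \<otimes>v x \<le> y \<longleftrightarrow> (\<forall>i k. A $ i $ k * x $ k \<le> y $ i)"
  by (simp add: less_eq_vec_def mmulv_le_iff)

lemma mdot_le_iff: "mdot x y \<le> z \<longleftrightarrow> (\<forall>i. x $ i * y $ i \<le> z)"
  unfolding mdot_def by (simp add: MAX_UNIV_le_iff)

lemma vmax_le_iff: "vmax x \<le> z \<longleftrightarrow> (\<forall>i. x $ i \<le> z)"
  unfolding vmax_def by (simp add: MAX_UNIV_le_iff)

lemma vmax_ge: "x $ i \<le> vmax x"
  using vmax_le_iff[of x] by blast

lemma vmax_attained: "\<exists>i. vmax x = x $ i"
  unfolding vmax_def by (rule MAX_UNIV_attained)

lemma mtr_le_iff: "mtr A \<le> z \<longleftrightarrow> (\<forall>i. A $ i $ i \<le> z)"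
  unfolding mtr_def by (simp add: MAX_UNIV_le_iff)

lemma mtr_ge: "A $ i $ i \<le> mtr A"
  using mtr_le_iff[of A] by blast

lemma mtr_nonneg: "0 \<le> A \<Longrightarrow> 0 \<le> mtr A"
  by (meson mat_nonneg_iff mtr_ge order_trans)

lemma mTr_le_iff:
  "mTr (A :: real^'n^'n) \<le> z \<longleftrightarrow> (\<forall>k\<in>{1..CARD('n)}. \<forall>i. mpow A k $ i $ i \<le> z)"
  unfolding mTr_def by (subst Max_le_iff) (auto simp: mtr_le_iff Suc_le_eq)

lemma mmul_nonneg: "0 \<le> A \<Longrightarrow> 0 \<le> B \<Longrightarrow> 0 \<le> A \<otimes> B"
  unfolding mat_nonneg_iff by (metis mmul_ge mult_nonneg_nonneg order_trans)

lemma mat_1_nonneg: "0 \<le> (mat 1 :: real^'n^'n)"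
  by (simp add: mat_nonneg_iff mat_def)

lemma mpow_nonneg: "0 \<le> A \<Longrightarrow> 0 \<le> mpow A k"
  by (induction k) (auto simp: mat_1_nonneg mmul_nonneg)

lemma mmul_mat_1_left: "0 \<le> A \<Longrightarrow> mat 1 \<otimes> A = A"
proof -
  assume A: "0 \<le> A"
  have "(mat 1 \<otimes> A) $ i $ j \<le> A $ i $ j" for i j
    unfolding mmul_le_iff using A by (auto simp: mat_nonneg_iff mat_def)
  moreover have "A $ i $ j \<le> (mat 1 \<otimes> A) $ i $ j" for i j
    using mmul_ge[of "mat 1" i i A j] by (simp add: mat_def)
  ultimately show ?thesis by (simp add: vec_eq_iff antisym)
qed

lemma mmul_mat_1_right: "0 \<le> A \<Longrightarrow> A \<otimes> mat 1 = A"
proof -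
  assume A: "0 \<le> A"
  have "(A \<otimes> mat 1) $ i $ j \<le> A $ i $ j" for i j
    unfolding mmul_le_iff using A by (auto simp: mat_nonneg_iff mat_def)
  moreover have "A $ i $ j \<le> (A \<otimes> mat 1) $ i $ j" for i j
    using mmul_ge[of A i j "mat 1" j] by (simp add: mat_def)
  ultimately show ?thesis by (simp add: vec_eq_iff antisym)
qed

text \<open>Each entry, in either bracketing, is attained by one product along a path
  \<open>i\<close>, \<open>l\<close>, \<open>k\<close>, \<open>j\<close>, and that product occurs in
  the other bracketing too. The outer factors multiply inner maxima, hence their
  nonnegativity.\<close>

lemma mmul_assoc:
  assumes A: "0 \<le> A" and D: "0 \<le> D"
  shows "(A \<otimes> B) \<otimes> D = A \<otimes> (B \<otimes> D)"
proof -
  have A': "0 \<le> A $ i $ j" and D': "0 \<le> D $ i $ j" for i j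
    using A D by (auto simp: mat_nonneg_iff)
  have "((A \<otimes> B) \<otimes> D) $ i $ j \<le> (A \<otimes> (B \<otimes> D)) $ i $ j" for i j
  proof -
    obtain k where k: "((A \<otimes> B) \<otimes> D) $ i $ j = (A \<otimes> B) $ i $ k * D $ k $ j"
      using mmul_attained by blast
    obtain l where l: "(A \<otimes> B) $ i $ k = A $ i $ l * B $ l $ k"
      using mmul_attained by blast
    have "((A \<otimes> B) \<otimes> D) $ i $ j = A $ i $ l * (B $ l $ k * D $ k $ j)"
      by (simp add: k l)
    also have "\<dots> \<le> A $ i $ l * (B \<otimes> D) $ l $ j"
      by (intro mult_left_mono mmul_ge A')
    also have "\<dots> \<le> (A \<otimes> (B \<otimes> D)) $ i $ j" by (rule mmul_ge)
    finally show ?thesis .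
  qed
  moreover have "(A \<otimes> (B \<otimes> D)) $ i $ j \<le> ((A \<otimes> B) \<otimes> D) $ i $ j" for i j
  proof -
    obtain k where k: "(A \<otimes> (B \<otimes> D)) $ i $ j = A $ i $ k * (B \<otimes> D) $ k $ j"
      using mmul_attained by blast
    obtain l where l: "(B \<otimes> D) $ k $ j = B $ k $ l * D $ l $ j"
      using mmul_attained by blast
    have "(A \<otimes> (B \<otimes> D)) $ i $ j = (A $ i $ k * B $ k $ l) * D $ l $ j"
      by (simp add: k l)
    also have "\<dots> \<le> (A \<otimes> B) $ i $ l * D $ l $ j"
      by (intro mult_right_mono mmul_ge D')
    also have "\<dots> \<le> ((A \<otimes> B) \<otimes> D) $ i $ j" by (rule mmul_ge)
    finally show ?thesis .
  qed
  ultimately show ?thesis by (simp add: vec_eq_iff antisym)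
qed

lemma mpow_add: "0 \<le> A \<Longrightarrow> mpow A (a + b) = mpow A a \<otimes> mpow A b"
  by (induction a) (simp_all add: mmul_mat_1_left mpow_nonneg mmul_assoc)

text \<open>A diagonal entry is the weight of a closed walk through some \<open>k\<close>, and the
  walk may as well start at \<open>k\<close>. This is what rotates words cyclically.\<close>

lemma mtr_commute: "(A \<otimes> B) $ i $ i \<le> mtr (B \<otimes> A)"
proof -
  obtain k where "(A \<otimes> B) $ i $ i = A $ i $ k * B $ k $ i" using mmul_attained by blast
  also have "\<dots> \<le> (B \<otimes> A) $ k $ k" using mmul_ge[of B k i A k] by (simp add: mult.commute)
  also have "\<dots> \<le> mtr (B \<otimes> A)" by (rule mtr_ge)
  finally show ?thesis .
qed

text \<open>Inserting the bound for \<open>Q\<close> into the one for \<open>P\<close> multiplies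
  the constants. This is the induction step for powers and for words alike.\<close>

lemma mmul_mult_vec_le:
  assumes "0 \<le> P" "\<And>i j. P $ i $ j * x $ j \<le> a * x $ i" "\<And>i j. Q $ i $ j * x $ j \<le> b * x $ i"
    and "0 \<le> b"
  shows "(P \<otimes> Q) $ i $ j * x $ j \<le> a * b * x $ i"
proof -
  obtain k where k: "(P \<otimes> Q) $ i $ j = P $ i $ k * Q $ k $ j"
    using mmul_attained by blast
  have "(P \<otimes> Q) $ i $ j * x $ j = P $ i $ k * (Q $ k $ j * x $ j)"
    by (simp add: k)
  also have "\<dots> \<le> P $ i $ k * (b * x $ k)"
    using assms(1,3) by (intro mult_left_mono) (auto simp: mat_nonneg_iff)
  also have "\<dots> = b * (P $ i $ k * x $ k)" by simp
  also have "\<dots> \<le> b * (a * x $ i)" using assms(2,4) by (intro mult_left_mono)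
  finally show ?thesis by (simp add: mult_ac)
qed

lemma mpow_mult_vec_le:
  assumes "0 \<le> A" "0 \<le> x" "A \<otimes>v x \<le> x"
  shows "mpow A k $ i $ j * x $ j \<le> x $ i"
proof (induction k arbitrary: i j)
  case 0
  then show ?case using assms(2) by (auto simp: mat_def less_eq_vec_def)
next
  case (Suc k)
  then show ?case
    using mmul_mult_vec_le[of A x 1 "mpow A k" 1] assms by (simp add: mmulv_le_vec_iff)
qed

lemma regular_iff: "regular x \<longleftrightarrow> (\<forall>i. 0 < x $ i)"
  by (auto simp: regular_def less_eq_vec_def less_le)

section \<open>The Kleene star\<close>

text \<open>Entries of powers are maximal weights of walks; \<open>f r\<close> is the vertex visited
  at time \<open>r\<close>.\<close>

lemma prod_walk_le_mpow:
  assumes "0 \<le> A" "a \<le> b"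
  shows "(\<Prod>r=a..<b. A $ f r $ f (Suc r)) \<le> mpow A (b - a) $ f a $ f b"
  using assms(2)
proof (induction rule: inc_induct)
  case base
  then show ?case by (simp add: mat_def)
next
  case (step a)
  have "(\<Prod>r=a..<b. A $ f r $ f (Suc r))
      = A $ f a $ f (Suc a) * (\<Prod>r=Suc a..<b. A $ f r $ f (Suc r))"
    using step.hyps by (simp add: prod.atLeast_Suc_lessThan)
  also have "\<dots> \<le> A $ f a $ f (Suc a) * mpow A (b - Suc a) $ f (Suc a) $ f b"
    using assms(1) step.IH by (intro mult_left_mono) (auto simp: mat_nonneg_iff)
  also have "\<dots> \<le> (A \<otimes> mpow A (b - Suc a)) $ f a $ f b" by (rule mmul_ge)
  also have "A \<otimes> mpow A (b - Suc a) = mpow A (b - a)"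
    using step.hyps by (metis Suc_diff_Suc mpow.simps(2))
  finally show ?case .
qed

text \<open>An optimal walk is built one edge at a time. Positivity excludes the off-diagonal zeros
  of the identity, to which no walk of length 0 corresponds.\<close>

lemma mpow_eq_prod_walk:
  assumes "0 \<le> A" "0 < mpow A k $ i $ j"
  shows "\<exists>f. f 0 = i \<and> f k = j \<and> mpow A k $ i $ j = (\<Prod>r=0..<k. A $ f r $ f (Suc r))"
  using assms(2)
proof (induction k arbitrary: i)
  case 0
  then show ?case by (intro exI[of _ "\<lambda>_. i"]) (auto simp: mat_def split: if_splits)
next
  case (Suc k)
  obtain p where p: "mpow A (Suc k) $ i $ j = A $ i $ p * mpow A k $ p $ j"
    using mmul_attained by fastforce
  have "0 \<le> mpow A k $ p $ j" using mpow_nonneg[OF assms(1)] by (auto simp: mat_nonneg_iff)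
  then have "0 < mpow A k $ p $ j"
    using Suc.prems p by (cases "mpow A k $ p $ j = 0") auto
  then obtain f where f: "f 0 = p" "f k = j"
      "mpow A k $ p $ j = (\<Prod>r=0..<k. A $ f r $ f (Suc r))"
    using Suc.IH by blast
  \<comment> \<open>The walk \<open>f\<close> with the vertex \<open>i\<close> put in front.\<close>
  let ?g = "case_nat i f"
  have "(\<Prod>r=0..<Suc k. A $ ?g r $ ?g (Suc r)) = A $ i $ f 0 * (\<Prod>r=0..<k. A $ f r $ f (Suc r))"
    by (subst prod.atLeast0_lessThan_Suc_shift) simp
  then show ?case using f p by (intro exI[of _ ?g]) simp
qed

text \<open>A walk with at least \<open>n\<close> edges contains a closed walk with at most \<open>n\<close> edges. Its weight is
  at most 1, so cutting it out does not decrease the weight.\<close>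

lemma mpow_le_mpow_less:
  fixes A :: "real^'n^'n"
  assumes A: "0 \<le> A" and tr: "mTr A \<le> 1" and k: "CARD('n) \<le> k"
  shows "\<exists>l<k. mpow A k $ i $ j \<le> mpow A l $ i $ j"
proof (cases "0 < mpow A k $ i $ j")
  case False
  moreover have "0 \<le> mpow A 0 $ i $ j"
    using mpow_nonneg[OF A] by (simp only: mat_nonneg_iff)
  ultimately show ?thesis
    using k by (intro exI[of _ 0]) (auto intro: order_trans less_le_trans)
next
  case True
  then obtain f where f: "f 0 = i" "f k = j"
      "mpow A k $ i $ j = (\<Prod>r=0..<k. A $ f r $ f (Suc r))"
    using mpow_eq_prod_walk[OF A] by blast
  \<comment> \<open>Pigeonhole on the first n + 1 vertices only, so that the closed walk found has
    at most n edges and is covered by \<open>mTr\<close>.\<close>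
  have "\<not> inj_on f {..CARD('n)}"
  proof
    assume "inj_on f {..CARD('n)}"
    then have "card {..CARD('n)} \<le> CARD('n)" by (intro card_inj_on_le) auto
    then show False by simp
  qed
  then obtain a b where ab: "a < b" "b \<le> CARD('n)" "f a = f b"
    by (smt (verit) atMost_iff inj_onI linorder_neqE_nat)
  have nn: "0 \<le> mpow A l $ x $ y" for l x y
    using mpow_nonneg[OF A] by (simp add: mat_nonneg_iff)
  have nn': "0 \<le> (\<Prod>r=x..<y. A $ f r $ f (Suc r))" for x y
    using A by (intro prod_nonneg) (auto simp: mat_nonneg_iff)
  have "b - a \<in> {1..CARD('n)}" using ab by auto
  then have "mpow A (b - a) $ f a $ f b \<le> 1"
    using tr ab(3) unfolding mTr_le_iff by metis
  then have cycle: "(\<Prod>r=a..<b. A $ f r $ f (Suc r)) \<le> 1"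
    using prod_walk_le_mpow[OF A, of a b f] ab by linarith
  have "mpow A k $ i $ j = (\<Prod>r=0..<a. A $ f r $ f (Suc r)) *
      ((\<Prod>r=a..<b. A $ f r $ f (Suc r)) * (\<Prod>r=b..<k. A $ f r $ f (Suc r)))"
    using ab k by (simp add: f(3) prod.atLeastLessThan_concat)
  also have "\<dots> \<le> (\<Prod>r=0..<a. A $ f r $ f (Suc r)) * (1 * (\<Prod>r=b..<k. A $ f r $ f (Suc r)))"
    by (intro mult_left_mono mult_right_mono cycle nn')
  also have "\<dots> \<le> mpow A a $ f 0 $ f a * mpow A (k - b) $ f b $ f k"
    using prod_walk_le_mpow[OF A, of 0 a f] prod_walk_le_mpow[OF A, of b k f] ab k
    by (auto intro!: mult_mono nn nn')
  also have "\<dots> \<le> mpow A (a + (k - b)) $ i $ j"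
    using mmul_ge[of "mpow A a" i "f a" "mpow A (k - b)" j] by (simp add: mpow_add[OF A] f ab)
  finally show ?thesis using ab k by (intro exI[of _ "a + (k - b)"]) auto
qed

lemma kleene_star_ge_less:
  fixes A :: "real^'n^'n"
  assumes "k < CARD('n)"
  shows "mpow A k $ i $ j \<le> kleene_star A $ i $ j"
  using assms unfolding kleene_star_def by simp

lemma kleene_star_attained:
  fixes A :: "real^'n^'n"
  shows "\<exists>k<CARD('n). kleene_star A $ i $ j = mpow A k $ i $ j"
proof -
  have "(MAX k\<in>{..<CARD('n)}. mpow A k $ i $ j) \<in> (\<lambda>k. mpow A k $ i $ j) ` {..<CARD('n)}"
    by (rule Max_in) (auto simp: lessThan_empty_iff)
  then show ?thesis by (auto simp: kleene_star_def)
qed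

text \<open>Walks are shortened until fewer than n edges remain, which are the lengths that the star
  collects.\<close>

lemma mpow_le_kleene_star:
  fixes A :: "real^'n^'n"
  assumes A: "0 \<le> A" and tr: "mTr A \<le> 1"
  shows "mpow A k $ i $ j \<le> kleene_star A $ i $ j"
proof (induction k rule: less_induct)
  case (less k)
  show ?case
  proof (cases "k < CARD('n)")
    case True
    then show ?thesis by (rule kleene_star_ge_less)
  next
    case False
    then show ?thesis using mpow_le_mpow_less[OF A tr, of k i j] less by force
  qed
qed

context
  fixes A :: "real^'n^'n"
  assumes A: "0 \<le> A" and tr: "mTr A \<le> 1"
begin

lemma kleene_star_diag: "1 \<le> kleene_star A $ i $ i"
  using mpow_le_kleene_star[OF A tr, of 0 i i] by (simp add: mat_def)

lemma kleene_star_ge: "A $ i $ j \<le> kleene_star A $ i $ j"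
  using mpow_le_kleene_star[OF A tr, of 1 i j] by (simp add: mmul_mat_1_right A)

lemma kleene_star_nonneg: "0 \<le> kleene_star A"
  using kleene_star_ge A unfolding mat_nonneg_iff by (meson order_trans)

lemma mult_kleene_star_le: "A $ i $ k * kleene_star A $ k $ j \<le> kleene_star A $ i $ j"
proof -
  obtain l where l: "kleene_star A $ k $ j = mpow A l $ k $ j"
    using kleene_star_attained by blast
  have "A $ i $ k * mpow A l $ k $ j \<le> mpow A (Suc l) $ i $ j" by (simp add: mmul_ge)
  also have "\<dots> \<le> kleene_star A $ i $ j" by (rule mpow_le_kleene_star[OF A tr])
  finally show ?thesis by (simp add: l)
qed

text \<open>Iterating the inequality for \<open>A\<close> gives it for every power, hence for the
  star; conversely \<open>A\<close> lies below its star.\<close>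

lemma kleene_star_mulv_le_iff:
  assumes "0 \<le> x"
  shows "kleene_star A \<otimes>v x \<le> x \<longleftrightarrow> A \<otimes>v x \<le> x"
proof
  assume "A \<otimes>v x \<le> x"
  then show "kleene_star A \<otimes>v x \<le> x"
    unfolding mmulv_le_vec_iff[of "kleene_star A"]
    using mpow_mult_vec_le[OF A assms] kleene_star_attained[of A] by metis
next
  assume "kleene_star A \<otimes>v x \<le> x"
  moreover have "A $ i $ k * x $ k \<le> kleene_star A $ i $ k * x $ k" for i k
    using kleene_star_ge assms by (intro mult_right_mono) (auto simp: less_eq_vec_def)
  ultimately show "A \<otimes>v x \<le> x"
    unfolding mmulv_le_vec_iff by (meson order_trans)
qed

text \<open>Every column of the star is a subsolution for \<open>A\<close>, hence one for the star
  itself.\<close>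

lemma kleene_star_idem_le:
  "kleene_star A $ i $ k * kleene_star A $ k $ j \<le> kleene_star A $ i $ j"
proof -
  have "0 \<le> column j (kleene_star A)"
    using kleene_star_nonneg by (simp add: less_eq_vec_def column_def)
  moreover have "A \<otimes>v column j (kleene_star A) \<le> column j (kleene_star A)"
    by (simp add: mmulv_le_vec_iff column_def mult_kleene_star_le)
  ultimately have "kleene_star A \<otimes>v column j (kleene_star A) \<le> column j (kleene_star A)"
    using kleene_star_mulv_le_iff by blast
  then show ?thesis by (simp add: mmulv_le_vec_iff column_def)
qed

lemma regular_subsolution_exists: "\<exists>x. regular x \<and> A \<otimes>v x \<le> x"
proof (intro exI conjI)
  \<comment> \<open>The entrywise maximum of all columns of the star; each column is a subsolution,
    and the diagonal entries make the maximum regular.\<close>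
  let ?x = "kleene_star A \<otimes>v 1"
  have "kleene_star A $ i $ i \<le> ?x $ i" for i
    using mmulv_ge[of "kleene_star A" i i 1] by simp
  then show "regular ?x"
    unfolding regular_iff using kleene_star_diag by (meson less_le_trans zero_less_one)
  have "A $ i $ k * ?x $ k \<le> ?x $ i" for i k
  proof -
    obtain j where "?x $ k = kleene_star A $ k $ j * 1 $ j" using mmulv_attained by blast
    then have "A $ i $ k * ?x $ k = A $ i $ k * kleene_star A $ k $ j" by simp
    also have "\<dots> \<le> kleene_star A $ i $ j * 1 $ j" by (simp add: mult_kleene_star_le)
    also have "\<dots> \<le> ?x $ i" by (rule mmulv_ge)
    finally show ?thesis .
  qed
  then show "A \<otimes>v ?x \<le> ?x" by (simp add: mmulv_le_vec_iff)
qed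

end

section \<open>Minimizing one objective\<close>

lemma word_prod_Nil: "word_prod C B [] = mat 1"
  and word_prod_Cons: "word_prod C B (i # is) = C \<otimes> mpow B i \<otimes> word_prod C B is"
  by (simp_all add: word_prod_def)

lemma word_prod_nonneg: "0 \<le> C \<Longrightarrow> 0 \<le> B \<Longrightarrow> 0 \<le> word_prod C B is"
  by (induction "is")
    (simp_all add: word_prod_Nil word_prod_Cons mat_1_nonneg mmul_nonneg mpow_nonneg)

text \<open>A power of \<open>B\<close> on the right merges into the last exponent, so a rotated
  word has the form counted in \<open>theta\<close> again.\<close>

lemma word_prod_mmul_mpow:
  assumes "0 \<le> C" "0 \<le> B"
  shows "word_prod C B (is @ [i]) \<otimes> mpow B l = word_prod C B (is @ [i + l])"
proof (induction "is")
  case Nil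
  then show ?case
    using assms
    by (simp add: word_prod_Nil word_prod_Cons mmul_mat_1_right mmul_nonneg mpow_nonneg mmul_assoc
        mpow_add)
next
  case (Cons a "is")
  then show ?case
    using assms by (simp add: word_prod_Cons mmul_assoc mmul_nonneg mpow_nonneg)
qed

lemma finite_words: "finite {is :: nat list. length is = k \<and> sum_list is \<le> N}"
proof (rule finite_subset)
  show "{is. length is = k \<and> sum_list is \<le> N} \<subseteq> {is. set is \<subseteq> {..N} \<and> length is = k}"
    by (auto dest: member_le_sum_list)
qed (simp add: finite_lists_length_eq)

lemma words_nonempty: "{is :: nat list. length is = k \<and> sum_list is \<le> N} \<noteq> {}"
proof -
  have "replicate k 0 \<in> {is :: nat list. length is = k \<and> sum_list is \<le> N}"
    by (simp add: sum_list_replicate)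
  then show ?thesis by blast
qed

text \<open>The two nested maxima together range over the nonempty words with at most n letters:
  \<open>length is\<close> counts the letters \<open>C\<close>, and \<open>sum_list is\<close> the
  letters \<open>B\<close>.\<close>

lemma theta_le_iff:
  fixes C B :: "real^'n^'n"
  shows "theta C B \<le> t \<longleftrightarrow> (\<forall>is. is \<noteq> [] \<and> length is + sum_list is \<le> CARD('n) \<longrightarrow>
      root (length is) (mtr (word_prod C B is)) \<le> t)"
proof -
  have Max_words: "(MAX is\<in>{is. length is = k \<and> sum_list is \<le> N}. f is) \<le> t \<longleftrightarrow>
      (\<forall>is. length is = k \<and> sum_list is \<le> N \<longrightarrow> f is \<le> t)" for k N and f :: "nat list \<Rightarrow> real"
    by (subst Max_le_iff)
      (use finite_words words_nonempty[of k N] in \<open>auto simp del: Collect_empty_eq\<close>)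
  have "theta C B \<le> t \<longleftrightarrow> (\<forall>k\<in>{1..CARD('n)}. \<forall>is.
      length is = k \<and> sum_list is \<le> CARD('n) - k \<longrightarrow> root k (mtr (word_prod C B is)) \<le> t)"
    unfolding theta_def by (subst Max_le_iff) (simp_all add: Max_words)
  also have "\<dots> \<longleftrightarrow> (\<forall>is. is \<noteq> [] \<and> length is + sum_list is \<le> CARD('n) \<longrightarrow>
      root (length is) (mtr (word_prod C B is)) \<le> t)"
  proof (intro iffI allI ballI impI, goal_cases)
    case (1 "is")
    then have "length is \<in> {1..CARD('n)}" "sum_list is \<le> CARD('n) - length is"
      by (auto simp: Suc_le_eq)
    with 1 show ?case by blast
  next
    case (2 k "is")
    then have "is \<noteq> []" "length is + sum_list is \<le> CARD('n)" by auto
    with 2 show ?case by blast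
  qed
  finally show ?thesis .
qed

lemma mtr_word_prod_le:
  fixes C B :: "real^'n^'n"
  assumes "0 \<le> C" "0 \<le> B" "is \<noteq> []" "length is + sum_list is \<le> CARD('n)"
  shows "mtr (word_prod C B is) \<le> theta C B ^ length is"
proof -
  have nn: "0 \<le> mtr (word_prod C B is)" by (simp add: mtr_nonneg word_prod_nonneg assms)
  have "root (length is) (mtr (word_prod C B is)) \<le> theta C B"
    using theta_le_iff[of C B "theta C B"] assms by blast
  then have "root (length is) (mtr (word_prod C B is)) ^ length is \<le> theta C B ^ length is"
    using nn by (intro power_mono real_root_ge_zero)
  then show ?thesis using nn assms by simp
qed

lemma diag_le_theta:
  fixes C B :: "real^'n^'n"
  assumes "0 \<le> C" "0 \<le> B"
  shows "C $ i $ i \<le> theta C B"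
proof -
  \<comment> \<open>The word \<open>[0]\<close> is the single letter \<open>C\<close>.\<close>
  have "mtr (word_prod C B [0]) \<le> theta C B ^ length [0::nat]"
    using assms by (intro mtr_word_prod_le) (auto simp: Suc_le_eq)
  then have "mtr C \<le> theta C B"
    using assms by (simp add: word_prod_Cons word_prod_Nil mmul_mat_1_right mat_1_nonneg)
  then show ?thesis using mtr_ge order_trans by blast
qed

text \<open>Each letter \<open>C\<close> costs a factor \<open>t\<close> and each letter
  \<open>B\<close> costs nothing.\<close>

lemma word_prod_mult_vec_le:
  assumes C: "0 \<le> C" and B: "0 \<le> B" and x: "0 \<le> x" "B \<otimes>v x \<le> x"
    and t: "0 \<le> t" "\<And>i j. C $ i $ j * x $ j \<le> t * x $ i"
  shows "word_prod C B is $ i $ j * x $ j \<le> t ^ length is * x $ i"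
proof (induction "is" arbitrary: i j)
  case Nil
  then show ?case using x by (auto simp: word_prod_Nil mat_def less_eq_vec_def)
next
  case (Cons a "is")
  have "(mpow B a \<otimes> word_prod C B is) $ i $ j * x $ j \<le> 1 * t ^ length is * x $ i" for i j
    using mpow_mult_vec_le[OF B x] Cons.IH t
    by (intro mmul_mult_vec_le) (auto simp: mpow_nonneg B)
  then have "(C \<otimes> (mpow B a \<otimes> word_prod C B is)) $ i $ j * x $ j \<le> t * t ^ length is * x $ i"
    using C t by (intro mmul_mult_vec_le) auto
  then show ?case by (simp add: word_prod_Cons)
qed

text \<open>On the diagonal the positive entry of \<open>x\<close> cancels, which bounds the trace
  of each word by a power of \<open>t\<close>; roots then give the claim. With \<open>t\<close> the
  objective value at \<open>x\<close>, this is the lower bound for the minimum.\<close>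

lemma theta_le:
  fixes C B :: "real^'n^'n"
  assumes "0 \<le> C" "0 \<le> B" "regular x" "B \<otimes>v x \<le> x"
    and t: "0 \<le> t" "\<And>i j. C $ i $ j * x $ j \<le> t * x $ i"
  shows "theta C B \<le> t"
  unfolding theta_le_iff
proof (intro allI impI)
  fix "is" :: "nat list"
  assume "is \<noteq> [] \<and> length is + sum_list is \<le> CARD('n)"
  then have len: "0 < length is" by simp
  have x: "0 \<le> x" "\<And>i. 0 < x $ i"
    using assms(3) regular_def regular_iff by blast+
  have "mtr (word_prod C B is) \<le> t ^ length is"
    unfolding mtr_le_iff
  proof
    fix i
    show "word_prod C B is $ i $ i \<le> t ^ length is"
      using word_prod_mult_vec_le[OF assms(1,2) x(1) assms(4) t, of "is" i i] x(2)[of i]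
      by simp
  qed
  then have "root (length is) (mtr (word_prod C B is)) \<le> root (length is) (t ^ length is)"
    using len by simp
  then show "root (length is) (mtr (word_prod C B is)) \<le> t"
    using len t by (simp add: real_root_power_cancel)
qed

text \<open>Along an optimal walk every factor is an entry of \<open>B\<close> or of the scaled
  \<open>C\<close>, so the walk spells a word. Words in \<open>word_prod\<close> start with
  \<open>C\<close>, so \<open>l\<close> leading letters \<open>B\<close> are kept apart; the power
  of \<open>t\<close> clears the scaling.\<close>

lemma mpow_madd_le_word:
  assumes C: "0 \<le> C" and B: "0 \<le> B" and t: "0 < t"
  shows "\<exists>l is. l + length is + sum_list is = k \<and>
    t ^ length is * mpow ((inverse t *\<^sub>R C) \<oplus> B) k $ i $ j \<le> (mpow B l \<otimes> word_prod C B is) $ i $ j"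
proof (induction k arbitrary: i)
  case 0
  then show ?case
    by (intro exI[of _ 0] exI[of _ "[]"]) (simp add: word_prod_Nil mmul_mat_1_left mat_1_nonneg)
next
  case (Suc k)
  let ?A = "(inverse t *\<^sub>R C) \<oplus> B"
  obtain p where p: "mpow ?A (Suc k) $ i $ j = ?A $ i $ p * mpow ?A k $ p $ j"
    using mmul_attained by fastforce
  obtain l "is" where w: "l + length is + sum_list is = k"
    "t ^ length is * mpow ?A k $ p $ j \<le> (mpow B l \<otimes> word_prod C B is) $ p $ j"
    using Suc.IH by blast
  note nn = C B word_prod_nonneg[OF C B] mpow_nonneg[OF B]
  consider "?A $ i $ p = B $ i $ p" | "?A $ i $ p = inverse t * C $ i $ p"
    by (simp add: madd_def) (metis max_def)
  then show ?case
  proof cases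
    case 1
    have "t ^ length is * mpow ?A (Suc k) $ i $ j = B $ i $ p * (t ^ length is * mpow ?A k $ p $ j)"
      using p 1 by simp
    also have "\<dots> \<le> B $ i $ p * (mpow B l \<otimes> word_prod C B is) $ p $ j"
      using w B by (intro mult_left_mono) (auto simp: mat_nonneg_iff)
    also have "\<dots> \<le> (B \<otimes> (mpow B l \<otimes> word_prod C B is)) $ i $ j" by (rule mmul_ge)
    also have "B \<otimes> (mpow B l \<otimes> word_prod C B is) = mpow B (Suc l) \<otimes> word_prod C B is"
      using nn by (simp add: mmul_assoc)
    finally show ?thesis using w by (intro exI[of _ "Suc l"] exI[of _ "is"]) auto
  next
    case 2
    \<comment> \<open>A new \<open>C\<close> in front turns the leading block of \<open>l\<close>
      letters \<open>B\<close> into its own exponent.\<close>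
    have "t ^ length (l # is) * mpow ?A (Suc k) $ i $ j
        = C $ i $ p * (t ^ length is * mpow ?A k $ p $ j)"
      using p 2 t by simp
    also have "\<dots> \<le> C $ i $ p * (mpow B l \<otimes> word_prod C B is) $ p $ j"
      using w C by (intro mult_left_mono) (auto simp: mat_nonneg_iff)
    also have "\<dots> \<le> (C \<otimes> (mpow B l \<otimes> word_prod C B is)) $ i $ j" by (rule mmul_ge)
    also have "\<dots> = (mpow B 0 \<otimes> word_prod C B (l # is)) $ i $ j"
      using nn by (simp add: word_prod_Cons mmul_mat_1_left mmul_nonneg)
    finally show ?thesis using w by (intro exI[of _ 0] exI[of _ "l # is"]) auto
  qed
qed

text \<open>A diagonal entry spells a closed word. Without \<open>C\<close> it is bounded by
  \<open>mTr B\<close>; otherwise rotation moves the leading letters \<open>B\<close> to the end,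
  and the power of \<open>theta\<close> bounding the trace cancels the scaling.\<close>

lemma mTr_theta_le:
  fixes C B :: "real^'n^'n"
  assumes C: "0 \<le> C" and B: "0 \<le> B" and tr: "mTr B \<le> 1" and pos: "0 < theta C B"
  shows "mTr ((inverse (theta C B) *\<^sub>R C) \<oplus> B) \<le> 1"
  unfolding mTr_le_iff
proof (intro ballI allI)
  fix k and i :: 'n
  assume k: "k \<in> {1..CARD('n)}"
  let ?t = "theta C B" and ?A = "(inverse (theta C B) *\<^sub>R C) \<oplus> B"
  obtain l "is" where w: "l + length is + sum_list is = k"
    "?t ^ length is * mpow ?A k $ i $ i \<le> (mpow B l \<otimes> word_prod C B is) $ i $ i"
    using mpow_madd_le_word[OF C B pos] by blast
  show "mpow ?A k $ i $ i \<le> 1"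
  proof (cases "is" rule: rev_cases)
    case Nil
    then have "mpow ?A k $ i $ i \<le> mpow B k $ i $ i"
      using w by (simp add: word_prod_Nil mmul_mat_1_right mpow_nonneg B)
    also have "\<dots> \<le> 1" using tr k by (simp add: mTr_le_iff)
    finally show ?thesis .
  next
    case (snoc js a)
    have "?t ^ length is * mpow ?A k $ i $ i \<le> mtr (word_prod C B is \<otimes> mpow B l)"
      using w(2) mtr_commute order_trans by blast
    also have "word_prod C B is \<otimes> mpow B l = word_prod C B (js @ [a + l])"
      by (simp add: snoc word_prod_mmul_mpow C B)
    \<comment> \<open>Rotation keeps the total length \<open>k\<close>, at most n, so this word is
      among those in \<open>theta\<close>.\<close>
    also have "mtr \<dots> \<le> ?t ^ length (js @ [a + l])"
      using w(1) k snoc by (intro mtr_word_prod_le) (auto simp: C B)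
    also have "\<dots> = ?t ^ length is * 1" by (simp add: snoc)
    finally show ?thesis using pos by (simp add: mult_le_cancel_left_pos)
  qed
qed

section \<open>One stage of the minimization as a single inequality\<close>

lemma madd_nonneg: "0 \<le> B \<Longrightarrow> 0 \<le> A \<oplus> B"
  by (simp add: mat_nonneg_iff madd_def le_max_iff_disj)

lemma madd_mulv_le_iff:
  assumes "0 \<le> x" "0 < t"
  shows "((inverse t *\<^sub>R C) \<oplus> B) \<otimes>v x \<le> x \<longleftrightarrow>
    (\<forall>i j. C $ i $ j * x $ j \<le> t * x $ i) \<and> B \<otimes>v x \<le> x"
proof -
  have "max (inverse t * C $ i $ j) (B $ i $ j) * x $ j \<le> x $ i \<longleftrightarrow>
      C $ i $ j * x $ j \<le> t * x $ i \<and> B $ i $ j * x $ j \<le> x $ i" for i j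
  proof -
    have "0 \<le> x $ j" using assms by (simp add: less_eq_vec_def)
    then have "max (inverse t * C $ i $ j) (B $ i $ j) * x $ j
        = max (inverse t * C $ i $ j * x $ j) (B $ i $ j * x $ j)"
      by (simp add: max_mult_distrib_right)
    moreover have "inverse t * C $ i $ j * x $ j \<le> x $ i \<longleftrightarrow> C $ i $ j * x $ j \<le> t * x $ i"
      using assms by (simp add: field_simps)
    ultimately show ?thesis by simp
  qed
  then show ?thesis by (auto simp: mmulv_le_vec_iff madd_def)
qed

lemma objective_le_iff:
  assumes "regular x"
  shows "mdot (conjugate x) (C \<otimes>v x) \<le> t \<longleftrightarrow> (\<forall>i j. C $ i $ j * x $ j \<le> t * x $ i)"
proof -
  have pos: "0 < x $ i" for i using assms regular_iff by blast
  have "conjugate x $ i * (C \<otimes>v x) $ i \<le> t \<longleftrightarrow> (C \<otimes>v x) $ i \<le> t * x $ i" for i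
    using pos[of i] by (simp add: conjugate_def field_simps)
  then show ?thesis by (simp add: mdot_le_iff mmulv_le_iff)
qed

text \<open>\<open>theta\<close> is a lower bound of the objective and is attained at a regular
  subsolution of the combined matrix, so minimizing means having value at most
  \<open>theta\<close>.\<close>

lemma arg_min_objective:
  fixes C B :: "real^'n^'n"
  assumes C: "0 \<le> C" and B: "0 \<le> B" and tr: "mTr B \<le> 1" and pos: "0 < theta C B"
  shows "{x. is_arg_min (\<lambda>x. mdot (conjugate x) (C \<otimes>v x)) (\<lambda>x. x \<in> {x. regular x \<and> B \<otimes>v x \<le> x}) x}
    = {x. regular x \<and> ((inverse (theta C B) *\<^sub>R C) \<oplus> B) \<otimes>v x \<le> x}"
proof -
  let ?t = "theta C B" and ?f = "\<lambda>x. mdot (conjugate x) (C \<otimes>v x)"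
  have lower: "?t \<le> ?f x" if x: "regular x" "B \<otimes>v x \<le> x" for x
  proof (rule theta_le[OF C B x])
    show le: "\<And>i j. C $ i $ j * x $ j \<le> ?f x * x $ i"
      using objective_le_iff[OF x(1), of C "?f x"] by blast
    have xpos: "0 < x $ i" for i using x regular_iff by blast
    \<comment> \<open>Any index would do: one diagonal entry shows that the objective value is
      nonnegative.\<close>
    have "0 \<le> C $ undefined $ undefined * x $ undefined"
      using C xpos by (simp add: mat_nonneg_iff less_imp_le)
    then have "0 \<le> ?f x * x $ undefined" using le order_trans by blast
    then show "0 \<le> ?f x" using xpos[of undefined] by (simp add: zero_le_mult_iff not_le)
  qed
  have iff: "regular x \<and> ((inverse ?t *\<^sub>R C) \<oplus> B) \<otimes>v x \<le> x \<longleftrightarrow>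
      regular x \<and> B \<otimes>v x \<le> x \<and> ?f x \<le> ?t" for x
    using madd_mulv_le_iff[OF _ pos] objective_le_iff regular_def by blast
  obtain z where "regular z" "B \<otimes>v z \<le> z" "?f z \<le> ?t"
    using regular_subsolution_exists[OF madd_nonneg[OF B] mTr_theta_le[OF C B tr pos]] iff by blast
  then have "is_arg_min ?f (\<lambda>x. regular x \<and> B \<otimes>v x \<le> x) x \<longleftrightarrow>
      regular x \<and> B \<otimes>v x \<le> x \<and> ?f x \<le> ?t" for x
    unfolding is_arg_min_linorder using lower by (meson order_trans)
  then show ?thesis by (simp add: iff)
qed

text \<open>Each stage yields a feasible set of the same shape with trace bound 1, so the
  one-objective result applies again. A positive trace of \<open>C s\<close> makes
  \<open>theta\<close> positive.\<close>

lemma lex_solutions_eq: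
  fixes C :: "nat \<Rightarrow> real^'n^'n" and B :: "real^'n^'n"
  assumes C: "\<And>s. s \<in> {1..m} \<Longrightarrow> 0 \<le> C s" "\<And>s. s \<in> {1..m} \<Longrightarrow> 0 < mtr (C s)"
    and B: "0 \<le> B" "mTr B \<le> 1"
  shows "s \<le> m \<Longrightarrow> 0 \<le> Bmat C B s \<and> mTr (Bmat C B s) \<le> 1 \<and>
    lex_solutions C B s = {x. regular x \<and> Bmat C B s \<otimes>v x \<le> x}"
proof (induction s)
  case 0
  then show ?case using B by simp
next
  case (Suc s)
  let ?C = "C (Suc s)" and ?B = "Bmat C B s"
  have IH: "0 \<le> ?B" "mTr ?B \<le> 1" "lex_solutions C B s = {x. regular x \<and> ?B \<otimes>v x \<le> x}"
    using Suc by auto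
  have Cs: "0 \<le> ?C" "0 < mtr ?C" using C[of "Suc s"] Suc.prems by auto
  obtain i where "mtr ?C = ?C $ i $ i"
    using MAX_UNIV_attained[of "\<lambda>i. ?C $ i $ i"] by (auto simp: mtr_def)
  then have pos: "0 < theta ?C ?B" using diag_le_theta[OF Cs(1) IH(1), of i] Cs(2) by linarith
  have "lex_solutions C B (Suc s) = {x. regular x \<and> Bmat C B (Suc s) \<otimes>v x \<le> x}"
    unfolding lex_solutions.simps IH(3) Bmat.simps by (rule arg_min_objective[OF Cs(1) IH(1,2) pos])
  then show ?case using mTr_theta_le[OF Cs(1) IH(1,2) pos] madd_nonneg[OF IH(1)] by simp
qed

section \<open>Best and worst differentiating solutions\<close>

text \<open>Domination by \<open>S\<close> carries the rest: a least element of \<open>S\<close> is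
  least in \<open>T\<close>, and minimal elements of \<open>S\<close> are minimal in
  \<open>T\<close>.\<close>

lemma minimal_given_byI:
  fixes S T :: "'a::order set"
  assumes fin: "finite S" and sub: "S \<subseteq> T" and dom: "\<And>x. x \<in> T \<Longrightarrow> \<exists>s\<in>S. s \<le> x"
  shows "minimal_given_by T S"
  unfolding minimal_given_by_def
proof (intro conjI)
  show "\<forall>s\<in>S. (\<forall>t\<in>S. s \<le> t) \<longrightarrow> (\<forall>x. minimal_in T x \<longleftrightarrow> x = s)"
  proof (intro ballI impI allI)
    fix s x assume s: "s \<in> S" "\<forall>t\<in>S. s \<le> t"
    then have "s \<le> y" if "y \<in> T" for y using dom[OF that] order_trans by blast
    then show "minimal_in T x \<longleftrightarrow> x = s"
      using s(1) sub unfolding minimal_in_def by (metis antisym subsetD)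
  qed
  have "\<exists>s\<in>S. \<forall>t\<in>S. s \<le> t" if x: "minimal_in T x" "\<And>y. minimal_in T y \<Longrightarrow> y = x" for x
  proof
    show "x \<in> S" using x(1) dom sub unfolding minimal_in_def by blast
    show "\<forall>t\<in>S. x \<le> t"
    proof
      fix t assume "t \<in> S"
      \<comment> \<open>By finiteness some minimal element of \<open>S\<close> lies below
        \<open>t\<close>; it is minimal in \<open>T\<close>, so by uniqueness it is
        \<open>x\<close>.\<close>
      then obtain u where u: "u \<in> S" "u \<le> t" "\<forall>v\<in>S. v \<le> u \<longrightarrow> v = u"
        using finite_has_minimal2[OF fin] by metis
      have "minimal_in T u"
        unfolding minimal_in_def
      proof (intro conjI ballI impI)
        fix y assume y: "y \<in> T" "y \<le> u"
        then obtain v where "v \<in> S" "v \<le> y" using dom by blast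
        then show "y = u" using u(3) y(2) by (metis antisym order_trans)
      qed (use u(1) sub in blast)
      then show "x \<le> t" using x(2) u(2) by blast
    qed
  qed
  then show "\<not> (\<exists>s\<in>S. \<forall>t\<in>S. s \<le> t) \<longrightarrow> \<not> (\<exists>!x. minimal_in T x)" by (metis (no_types))
qed (use assms in auto)

section \<open>Solution sets generated by the columns of a positive matrix\<close>

context
  fixes G :: "real^'n^'n" and X :: "(real^'n) set"
  assumes pos: "\<And>i j. 0 < G $ i $ j"
    and diag: "\<And>i. 1 \<le> G $ i $ i"
    and idem: "\<And>i k j. G $ i $ k * G $ k $ j \<le> G $ i $ j"
    and X_eq: "X = {x. regular x \<and> G \<otimes>v x \<le> x}"
begin

lemma in_X_iff: "x \<in> X \<longleftrightarrow> (\<forall>i. 0 < x $ i) \<and> (\<forall>i j. G $ i $ j * x $ j \<le> x $ i)"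
  unfolding X_eq by (simp add: regular_iff mmulv_le_vec_iff)

text \<open>A solution is its own parameter vector, since the diagonal of \<open>G\<close> turns the
  inequality into equality. Conversely, \<open>idem\<close> makes every combination of columns a
  solution, and positivity of \<open>G\<close> makes it regular.\<close>

lemma X_eq_range: "X = {G \<otimes>v u | u. 0 \<le> u \<and> u \<noteq> 0}"
proof (intro set_eqI iffI)
  fix x assume x: "x \<in> X"
  have "x $ i \<le> (G \<otimes>v x) $ i" for i
  proof -
    have "1 * x $ i \<le> G $ i $ i * x $ i"
      using diag x by (intro mult_right_mono) (auto simp: in_X_iff less_imp_le)
    also have "\<dots> \<le> (G \<otimes>v x) $ i" by (rule mmulv_ge)
    finally show ?thesis by simp
  qed
  moreover have "(G \<otimes>v x) $ i \<le> x $ i" for i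
    using x by (simp add: mmulv_le_iff in_X_iff)
  ultimately have "x = G \<otimes>v x" by (simp add: vec_eq_iff antisym)
  moreover have "0 \<le> x" "x \<noteq> 0"
    using x by (auto simp: in_X_iff less_eq_vec_def less_imp_le)
  ultimately show "x \<in> {G \<otimes>v u | u. 0 \<le> u \<and> u \<noteq> 0}" by blast
next
  fix x assume "x \<in> {G \<otimes>v u | u. 0 \<le> u \<and> u \<noteq> 0}"
  then obtain u where u: "x = G \<otimes>v u" "\<And>i. 0 \<le> u $ i" "u \<noteq> 0"
    by (auto simp: less_eq_vec_def)
  then obtain k where "0 < u $ k" by (metis less_le vec_eq_iff zero_index)
  then have "0 < x $ i" for i
    using pos mmulv_ge[of G i k u] u(1) by (meson less_le_trans mult_pos_pos)
  moreover have "G $ i $ j * x $ j \<le> x $ i" for i j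
  proof -
    obtain l where l: "x $ j = G $ j $ l * u $ l" using mmulv_attained u(1) by blast
    have "G $ i $ j * x $ j = (G $ i $ j * G $ j $ l) * u $ l" by (simp add: l)
    also have "\<dots> \<le> G $ i $ l * u $ l" by (intro mult_right_mono idem u(2))
    also have "\<dots> \<le> x $ i" unfolding u(1) by (rule mmulv_ge)
    finally show ?thesis .
  qed
  ultimately show "x \<in> X" by (simp add: in_X_iff)
qed

lemma vmax_column_pos: "0 < vmax (column k G)"
  using pos[of k k] vmax_ge[of "column k G" k] by (simp add: column_def)

lemma mdot_1_eq_vmax: "mdot 1 x = vmax x" "mdot x 1 = vmax x"
  by (simp_all add: mdot_def vmax_def)

definition normalized_column :: "'n \<Rightarrow> real^'n" where
  "normalized_column k = inverse (vmax (column k G)) *\<^sub>R column k G"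

lemma normalized_column_nth: "normalized_column k $ i = G $ i $ k / vmax (column k G)"
  by (simp add: normalized_column_def column_def divide_inverse mult.commute)

lemma normalized_column_in_X: "normalized_column k \<in> X"
  using pos vmax_column_pos[of k] idem
  by (auto simp: in_X_iff normalized_column_nth divide_right_mono less_imp_le)

lemma vmax_normalized_column: "vmax (normalized_column k) = 1"
proof (rule antisym)
  show "vmax (normalized_column k) \<le> 1"
    using vmax_ge[of "column k G"] vmax_column_pos[of k]
    by (simp add: vmax_le_iff normalized_column_nth column_def)
  obtain i where "vmax (column k G) = column k G $ i" using vmax_attained by blast
  then have "normalized_column k $ i = 1"
    using vmax_column_pos[of k] by (simp add: normalized_column_nth column_def)
  then show "1 \<le> vmax (normalized_column k)" using vmax_ge by metis
qed

text \<open>Conjugation inverts the scaling factor; the right side is the quantity maximized over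
  the columns.\<close>

lemma vmax_conjugate_normalized_column:
  "vmax (conjugate (normalized_column k))
    = vmax (column k G) * vmax (conjugate (column k G))"
proof -
  have eq: "conjugate (normalized_column k) $ i
      = vmax (column k G) * conjugate (column k G) $ i" for i
    using pos[of i k] vmax_column_pos[of k]
    by (simp add: conjugate_def normalized_column_nth column_def divide_inverse)
  show ?thesis
  proof (rule antisym)
    show "vmax (conjugate (normalized_column k))
        \<le> vmax (column k G) * vmax (conjugate (column k G))"
      using vmax_ge vmax_column_pos[of k]
      by (auto simp: vmax_le_iff[of "conjugate (normalized_column k)"] eq intro!: mult_left_mono)
    show "vmax (column k G) * vmax (conjugate (column k G))
        \<le> vmax (conjugate (normalized_column k))"
      using vmax_attained[of "conjugate (column k G)"] vmax_ge eq by metis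
  qed
qed

text \<open>An entry of \<open>x\<close> equal to 1 comes from a single column \<open>k\<close>,
  which forces the coefficient \<open>u $ k\<close> to be at least the normalizing factor of that
  column.\<close>

lemma normalized_column_le:
  assumes "x \<in> X" "vmax x = 1"
  shows "\<exists>k. normalized_column k \<le> x"
proof -
  obtain u where u: "x = G \<otimes>v u" "\<And>i. 0 \<le> u $ i"
    using assms(1) unfolding X_eq_range by (auto simp: less_eq_vec_def)
  obtain i where "x $ i = 1" using vmax_attained assms(2) by metis
  then obtain k where k: "G $ i $ k * u $ k = 1" using mmulv_attained u(1) by metis
  have "G $ i $ k * u $ k \<le> vmax (column k G) * u $ k"
    using vmax_ge[of "column k G" i] u(2) by (intro mult_right_mono) (simp_all add: column_def)
  then have uk: "1 / vmax (column k G) \<le> u $ k"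
    using k vmax_column_pos[of k] by (simp add: field_simps)
  have "normalized_column k $ j \<le> x $ j" for j
  proof -
    have "normalized_column k $ j = G $ j $ k * (1 / vmax (column k G))"
      by (simp add: normalized_column_nth)
    also have "\<dots> \<le> G $ j $ k * u $ k"
      using pos by (intro mult_left_mono uk) (simp add: less_imp_le)
    also have "\<dots> \<le> x $ j" unfolding u(1) by (rule mmulv_ge)
    finally show ?thesis .
  qed
  then show ?thesis by (auto simp: less_eq_vec_def)
qed

lemma vmax_conjugate_antimono:
  assumes "regular x" "x \<le> y"
  shows "vmax (conjugate y) \<le> vmax (conjugate x)"
  unfolding vmax_le_iff
proof
  fix i
  have "0 < x $ i" "x $ i \<le> y $ i" using assms by (auto simp: regular_iff less_eq_vec_def)
  then have "conjugate y $ i \<le> conjugate x $ i" by (simp add: conjugate_def le_imp_inverse_le)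
  then show "conjugate y $ i \<le> vmax (conjugate x)" using vmax_ge order_trans by blast
qed

text \<open>Passing to a normalized column below \<open>x\<close> can only increase the objective,
  so the optimum is attained at columns and every optimal vector dominates an optimal
  column.\<close>

lemma best_diff_given_by:
  "minimal_given_by (best_diff X)
    {inverse (vmax (column k G)) *\<^sub>R column k G | k.
      is_arg_max (\<lambda>j. vmax (column j G) * vmax (conjugate (column j G))) (\<lambda>_. True) k}"
proof -
  let ?v = "\<lambda>j. vmax (column j G) * vmax (conjugate (column j G))"
  have upper: "\<exists>k. normalized_column k \<le> x \<and> vmax (conjugate x) \<le> ?v k"
    if x: "x \<in> X" "vmax x = 1" for x
    using normalized_column_le[OF x] normalized_column_in_X vmax_conjugate_antimono
    by (metis (no_types, lifting) X_eq mem_Collect_eq vmax_conjugate_normalized_column)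
  show ?thesis
    unfolding normalized_column_def[symmetric]
  proof (rule minimal_given_byI)
    show "{normalized_column k |k. is_arg_max ?v (\<lambda>_. True) k} \<subseteq> best_diff X"
      unfolding best_diff_def is_arg_max_linorder mdot_1_eq_vmax
      using upper normalized_column_in_X vmax_normalized_column
      by (auto simp: vmax_conjugate_normalized_column) (meson order_trans)
    fix x assume "x \<in> best_diff X"
    then have x: "x \<in> X" "vmax x = 1"
      "\<And>y. y \<in> X \<Longrightarrow> vmax y = 1 \<Longrightarrow> vmax (conjugate y) \<le> vmax (conjugate x)"
      by (auto simp: best_diff_def is_arg_max_linorder mdot_1_eq_vmax)
    obtain k where k: "normalized_column k \<le> x" "vmax (conjugate x) \<le> ?v k"
      using upper[OF x(1,2)] by blast
    have "?v j \<le> vmax (conjugate x)" for j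
      using x(3)[OF normalized_column_in_X vmax_normalized_column]
      by (simp add: vmax_conjugate_normalized_column)
    then have "is_arg_max ?v (\<lambda>_. True) k"
      unfolding is_arg_max_linorder using k(2) order_trans by blast
    then show "\<exists>s\<in>{normalized_column k |k. is_arg_max ?v (\<lambda>_. True) k}. s \<le> x"
      using k(1) by blast
  qed simp
qed

text \<open>The inequalities for \<open>x\<close> and the normalization bound each entry
  \<open>x $ j\<close> by the inverse norm of column \<open>j\<close>. These bounds form a
  normalized solution, and the greatest one has the smallest conjugate.\<close>

lemma worst_diff_greatest: "greatest_in (worst_diff X) (conjugate (1 v\<otimes> G))"
proof -
  let ?y = "conjugate (1 v\<otimes> G)"
  have y_nth: "?y $ j = 1 / vmax (column j G)" for j
    using vmax_column_pos[of j]
    by (simp add: conjugate_def vmulm_def vmax_def column_def divide_inverse)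
  have upper: "x \<le> ?y" if x: "x \<in> X" "vmax x = 1" for x
  proof -
    have "x $ j \<le> 1 / vmax (column j G)" for j
    proof -
      obtain i where i: "vmax (column j G) = G $ i $ j"
        using vmax_attained[of "column j G"] by (auto simp: column_def)
      have "G $ i $ j * x $ j \<le> x $ i" using x(1) in_X_iff by blast
      also have "\<dots> \<le> 1" using vmax_ge[of x i] x(2) by simp
      finally show ?thesis using vmax_column_pos[of j] by (simp add: i field_simps)
    qed
    then show ?thesis by (simp add: less_eq_vec_def y_nth)
  qed
  \<comment> \<open>The bounds satisfy the defining inequality: \<open>idem\<close> is applied at a
    row \<open>l\<close> where column \<open>i\<close> attains its norm.\<close>
  have "G $ i $ j / vmax (column j G) \<le> 1 / vmax (column i G)" for i j
  proof -
    obtain l where l: "vmax (column i G) = G $ l $ i"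
      using vmax_attained[of "column i G"] by (auto simp: column_def)
    have "G $ l $ i * G $ i $ j \<le> G $ l $ j" by (rule idem)
    also have "\<dots> \<le> vmax (column j G)" using vmax_ge[of "column j G" l] by (simp add: column_def)
    finally show ?thesis
      using vmax_column_pos[of i] vmax_column_pos[of j] by (simp add: l field_simps)
  qed
  then have y_in_X: "?y \<in> X" by (simp add: in_X_iff y_nth vmax_column_pos)
  have "vmax ?y = 1"
  proof (rule antisym)
    show "vmax ?y \<le> 1"
      unfolding vmax_le_iff
    proof
      fix i
      have "1 \<le> vmax (column i G)"
        using diag[of i] vmax_ge[of "column i G" i] by (simp add: column_def)
      then show "?y $ i \<le> 1" by (simp add: y_nth)
    qed
    obtain k where k: "vmax ?y = ?y $ k" using vmax_attained by blast
    \<comment> \<open>A normalized column has an entry 1 and lies below \<open>?y\<close>, so the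
      norm of \<open>?y\<close> is at least 1.\<close>
    let ?x = "normalized_column k"
    obtain i where "?x $ i = 1" using vmax_attained vmax_normalized_column by metis
    then have "1 \<le> ?y $ i"
      using upper[OF normalized_column_in_X vmax_normalized_column, of k]
      by (metis less_eq_vec_def)
    then show "1 \<le> vmax ?y" using vmax_ge order_trans by blast
  qed
  then show ?thesis
    unfolding greatest_in_def worst_diff_def is_arg_min_linorder mdot_1_eq_vmax
    using y_in_X upper vmax_conjugate_antimono X_eq by auto
qed

end

section \<open>Positivity and idempotence of the final Kleene star\<close>

theorem theorem10:
  fixes C :: "nat \<Rightarrow> real^'n^'n" and B G :: "real^'n^'n" and m :: nat
    and X :: "(real^'n) set"
  assumes "m \<ge> 1"
    and "\<And>s. s \<in> {1..m} \<Longrightarrow> pairwise_comparison (C s)"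
    and "\<And>s. s \<in> {1..m} \<Longrightarrow> mspectral_radius (C s) \<noteq> 0"
    and "0 \<le> B" and "mTr B \<le> 1"
  defines "G \<equiv> kleene_star (Bmat C B m)"
    and "X \<equiv> lex_solutions C B m"
  shows "X = {G \<otimes>v u | u. 0 \<le> u \<and> u \<noteq> 0}
    \<and> minimal_given_by (best_diff X)
           {inverse (vmax (column k G)) *\<^sub>R column k G | k.
              is_arg_max (\<lambda>j. vmax (column j G) * vmax (conjugate (column j G))) (\<lambda>_. True) k}
    \<and> greatest_in (worst_diff X) (conjugate (1 v\<otimes> G))"
proof -
  have Cpos: "0 < C s $ i $ j" if "s \<in> {1..m}" for s i j
    using assms(2)[OF that] unfolding pairwise_comparison_def by blast
  have C: "0 \<le> C s" "0 < mtr (C s)" if "s \<in> {1..m}" for s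
    using Cpos[OF that] less_le_trans[OF Cpos[OF that] mtr_ge]
    by (simp_all add: mat_nonneg_iff less_imp_le)
  have lex: "0 \<le> Bmat C B s \<and> mTr (Bmat C B s) \<le> 1 \<and>
      lex_solutions C B s = {x. regular x \<and> Bmat C B s \<otimes>v x \<le> x}" if "s \<le> m" for s
    by (rule lex_solutions_eq[of m]) (use C assms(4,5) that in blast)+
  let ?A = "Bmat C B m"
  have A: "0 \<le> ?A" and tr: "mTr ?A \<le> 1" and X: "X = {x. regular x \<and> ?A \<otimes>v x \<le> x}"
    using lex[of m] by (auto simp: X_def)
  have "X = {x. regular x \<and> G \<otimes>v x \<le> x}"
    unfolding X G_def using kleene_star_mulv_le_iff[OF A tr] by (auto simp: regular_def)
  moreover have "0 < G $ i $ j" for i j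
  proof -
    \<comment> \<open>The last stage adds a positive multiple of the entrywise positive
      \<open>C m\<close>, which makes \<open>G\<close> positive.\<close>
    obtain s where s: "m = Suc s" using assms(1) by (cases m) auto
    let ?t = "theta (C m) (Bmat C B s)"
    \<comment> \<open>Reciprocity and positivity force the diagonal of \<open>C m\<close> to be 1,
      and diagonal entries lie below \<open>theta\<close>.\<close>
    have "1 \<le> ?t"
    proof -
      have m: "m \<in> {1..m}" using assms(1) by simp
      have "C m $ i $ i = 1 / C m $ i $ i"
        using assms(2)[OF m] unfolding pairwise_comparison_def by blast
      then have "C m $ i $ i * C m $ i $ i = 1"
        using Cpos[OF m, of i i] by (metis nonzero_eq_divide_eq less_irrefl)
      then have "C m $ i $ i = 1"
        using Cpos[OF m, of i i] square_eq_1_iff[of "C m $ i $ i"] by linarith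
      then show ?thesis
        using diag_le_theta[OF C(1), of m "Bmat C B s" i] lex[of s] assms(1) s by auto
    qed
    then have "0 < inverse ?t * C m $ i $ j" using Cpos[of m] assms(1) by simp
    also have "\<dots> \<le> ?A $ i $ j" by (simp add: s madd_def)
    also have "\<dots> \<le> G $ i $ j" unfolding G_def by (rule kleene_star_ge[OF A tr])
    finally show ?thesis .
  qed
  moreover have "1 \<le> G $ i $ i" for i
    unfolding G_def by (rule kleene_star_diag[OF A tr])
  moreover have "G $ i $ k * G $ k $ j \<le> G $ i $ j" for i k j
    unfolding G_def by (rule kleene_star_idem_le[OF A tr])
  ultimately show ?thesis
    using X_eq_range[of G X] best_diff_given_by[of G X] worst_diff_greatest[of G X] by blast
qed

end
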